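(* For $n \geq 0$ and $\ell \geq 1$ the polynomials $\gamma(P_n^\ell,x)$ satisfy: (A1) $\gamma(P_0^\ell,x)=1$; (A2) $\gamma(P_1^\ell,x)=x$; (A3) $\gamma(P_n^\ell,x) = nx + x\sum_{j=1}^{n-1} \gamma(P_{n-j}^\ell,x)$ for $2 \leq n \leq \ell+1$; (A4) $\gamma(P_n^\ell,x) = (2\ell+2-n)x + x\sum_{j=1}^{n-1} \gamma(P_{n-j}^\ell,x)$ for $\ell+2 \leq n \leq 2\ell$; (A5) $\gamma(P_n^\ell,x) = x\sum_{j=1}^{2\ell+1} \gamma(P_{n-j}^\ell,x)$ for $n \geq 2\ell+1$. Alternatively, they satisfy: (B1) $\gamma(P_0^{\ell},x)=1$; (B2) $\gamma(P_n^{\ell},x) = (1+x)^n -1$ for $1 \leq n \leq \ell+1$; (B3) $\gamma(P_n^{\ell},x) = (1+x)\gamma(P_{n-1}^{\ell},x) - x$ for $\ell+2 \leq n \leq 2\ell+1$; (B4) $\gamma(P_n^{\ell},x) = (1+x)\gamma(P_{n-1}^{\ell},x) - x\gamma(P_{n-2(\ell+1)}^{\ell},x)$ for $n \geq 2\ell+2$.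
   Context: A dominating set in a graph $G$ is a set $D$ of vertices such that every vertex of $G$ is in $D$ or adjacent to a vertex of $D$. $\gamma_k(G)$ denotes the number of dominating sets of $G$ of size $k$, and the domination polynomial is $\gamma(G,x)=\sum_{k\geq 0}\gamma_k(G)x^k$. For a graph $G$ and positive integer $\ell$, the $\ell$th power of $G$ is the graph on the same vertex set in which two distinct vertices are adjacent iff their distance in $G$ is at most $\ell$. $P^\ell_n$ is the $\ell$th power of the path on $n$ vertices; $P^\ell_0$ is the graph with no vertices, which has exactly one dominating set (the empty set). *)

theory Defs
  imports "HOL-Computational_Algebra.Polynomial" "Graph_Theory.Graph_Theory"
begin

text \<open>
  A finite simple graph is represented as a finite digraph without parallel arcs whose arc relation
  is symmetric and irreflexive, i.e. as an instance of the locale \<open>pair_graph\<close>: an edge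
  \<open>{u, v}\<close> corresponds to the two arcs \<open>(u, v)\<close> and \<open>(v, u)\<close>.
\<close>

definition dominating_set :: "'a pair_pre_digraph \<Rightarrow> 'a set \<Rightarrow> bool" where
  "dominating_set G D \<longleftrightarrow>
     D \<subseteq> pverts G \<and> (\<forall>v\<in>pverts G. v \<in> D \<or> (\<exists>u\<in>D. (v, u) \<in> parcs G))"

definition num_dominating :: "'a pair_pre_digraph \<Rightarrow> nat \<Rightarrow> nat" where
  "num_dominating G k = card {D. dominating_set G D \<and> card D = k}"

text \<open>
  For a finite graph the coefficients vanish for \<open>k\<close> beyond the number of vertices,
  so the sum over all \<open>k\<close> may be cut off there. Integer coefficients are used since
  the recurrences involve subtraction.
\<close>

definition domination_poly :: "'a pair_pre_digraph \<Rightarrow> int poly" where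
  "domination_poly G = (\<Sum>k\<le>card (pverts G). monom (int (num_dominating G k)) k)"

text \<open>
  With unit weights \<open>wf_digraph.\<mu>\<close> is the usual distance; it is \<open>\<infinity>\<close> between
  vertices not joined by a walk.
\<close>

definition graph_dist :: "'a pair_pre_digraph \<Rightarrow> 'a \<Rightarrow> 'a \<Rightarrow> ereal" where
  "graph_dist G = wf_digraph.\<mu> (with_proj G) (\<lambda>_. 1)"

definition graph_power :: "nat \<Rightarrow> 'a pair_pre_digraph \<Rightarrow> 'a pair_pre_digraph" where
  "graph_power l G =
     \<lparr>pverts = pverts G,
      parcs = {(u, v). u \<in> pverts G \<and> v \<in> pverts G \<and> u \<noteq> v \<and> graph_dist G u v \<le> ereal (real l)}\<rparr>"

definition path_graph :: "nat \<Rightarrow> nat pair_pre_digraph" where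
  "path_graph n =
     \<lparr>pverts = {..<n},
      parcs = {(u, v). u < n \<and> v < n \<and> (v = Suc u \<or> u = Suc v)}\<rparr>"

abbreviation path_power_poly :: "nat \<Rightarrow> nat \<Rightarrow> int poly" (\<open>\<gamma>P\<close>) where
  "\<gamma>P l n \<equiv> domination_poly (graph_power l (path_graph n))"

abbreviation X :: "int poly" where
  "X \<equiv> [:0, 1:]"

lemma pair_graph_path_graph: "pair_graph (path_graph n)"
proof
  show "finite (parcs (path_graph n))"
    by (rule finite_subset[of _ "{..<n} \<times> {..<n}"]) (auto simp: path_graph_def)
qed (auto simp: path_graph_def symmetric_def sym_def)

lemma graph_dist_eq:
  assumes "pair_graph G"
  shows "graph_dist G u v = (INF p\<in>{p. pre_digraph.awalk (with_proj G) u p v}. ereal (real (length p)))"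
proof -
  interpret pair_graph G by fact
  have "awalk_cost (\<lambda>_. 1) p = real (length p)" for p :: "('a \<times> 'a) list"
    by (induction p) (auto simp: awalk_cost_def)
  then show ?thesis
    by (simp add: graph_dist_def \<mu>_def)
qed

lemma graph_dist_commute:
  assumes "pair_graph G"
  shows "graph_dist G u v = graph_dist G v u"
proof -
  interpret pair_graph G by fact
  have rev: "awalk y (rev (map prod.swap p)) x \<and> length (rev (map prod.swap p)) = length p"
    if "awalk x p y" for x p y
    using that
  proof (induction p arbitrary: x)
    case Nil
    then show ?case by (auto simp: awalk_Nil_iff)
  next
    case (Cons e p)
    then have e: "e \<in> parcs G" "fst e = x" "awalk (snd e) p y"
      by (auto simp: awalk_Cons_iff)
    then have "awalk (snd e) [prod.swap e] x"
      using arcs_symmetric by (cases e) (auto simp: awalk_Cons_iff awalk_Nil_iff dest: in_arcsD1)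
    with Cons.IH[OF e(3)] show ?case
      by (auto intro: awalk_appendI)
  qed
  have le: "graph_dist G y x \<le> graph_dist G x y" for x y
    unfolding graph_dist_eq[OF assms]
  proof (rule INF_greatest)
    fix p assume "p \<in> {p. awalk x p y}"
    then have "awalk y (rev (map prod.swap p)) x" using rev by blast
    then show "(INF q\<in>{q. awalk y q x}. ereal (real (length q))) \<le> ereal (real (length p))"
      by (intro INF_lower2[of "rev (map prod.swap p)"]) auto
  qed
  show ?thesis using le by (intro antisym)
qed

lemma pair_graph_graph_power:
  assumes "pair_graph G"
  shows "pair_graph (graph_power l G)"
proof -
  interpret pair_graph G by fact
  show ?thesis
  proof
    show "finite (parcs (graph_power l G))"
      by (rule finite_subset[of _ "pverts G \<times> pverts G"]) (auto simp: graph_power_def)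
  qed (auto simp: graph_power_def symmetric_def sym_def graph_dist_commute[OF assms])
qed

end

theory Submission
  imports Defs
begin

text \<open>
  Vertices of the path are at distance \<open>\<bar>u - v\<bar>\<close>, so a dominating set of its power is a set of
  numbers whose consecutive gaps are at most \<open>2 * l + 1\<close> and that comes within \<open>l\<close> of both ends.
  Deleting the largest element of a dominating set with at least two elements, together with the gap
  \<open>j\<close> below it, leaves a dominating set of the path with \<open>j\<close> vertices fewer, and this is reversible.
  Hence \<open>\<gamma>P l n\<close> is \<open>X\<close> times the number of dominating vertices plus \<open>X\<close> times the sum of the
  \<open>\<gamma>P l (n - j)\<close>. All the recurrences (A) are instances of this identity, and taking differences
  of consecutive instances gives the recurrences (B).
\<close>

section \<open>Distances in the path\<close>

lemma path_graph_simps [simp]: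
  "pverts (path_graph n) = {..<n}"
  "(u, v) \<in> parcs (path_graph n) \<longleftrightarrow> u < n \<and> v < n \<and> (v = Suc u \<or> u = Suc v)"
  by (auto simp: path_graph_def)

lemma graph_power_simps [simp]:
  "pverts (graph_power l G) = pverts G"
  "(u, v) \<in> parcs (graph_power l G) \<longleftrightarrow>
    u \<in> pverts G \<and> v \<in> pverts G \<and> u \<noteq> v \<and> graph_dist G u v \<le> ereal (real l)"
  by (auto simp: graph_power_def)

text \<open>Each arc changes the vertex number by one. Two inequalities replace
  \<open>\<bar>u - v\<bar>\<close>, since subtraction on \<open>nat\<close> truncates.\<close>

lemma path_awalk_length:
  assumes "pre_digraph.awalk (with_proj (path_graph n)) u p v"
  shows "u \<le> v + length p" "v \<le> u + length p"
proof -
  interpret pair_graph "path_graph n" by (rule pair_graph_path_graph)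
  have "u \<le> v + length p \<and> v \<le> u + length p" if "awalk u p v" for u
    using that
  proof (induction p arbitrary: u)
    case Nil
    then show ?case by (simp add: awalk_Nil_iff)
  next
    case (Cons e p)
    then have "e \<in> parcs (path_graph n)" "fst e = u" "awalk (snd e) p v"
      by (auto simp: awalk_Cons_iff)
    with Cons.IH[of "snd e"] show ?case
      by (cases e) auto
  qed
  with assms show "u \<le> v + length p" "v \<le> u + length p" by auto
qed

lemma path_awalk_exists:
  assumes "u + d < n"
  shows "\<exists>p. pre_digraph.awalk (with_proj (path_graph n)) u p (u + d) \<and> length p = d"
proof -
  interpret pair_graph "path_graph n" by (rule pair_graph_path_graph)
  show ?thesis
    using assms
  proof (induction d arbitrary: u)
    case 0
    then show ?case by (auto simp: awalk_Nil_iff)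
  next
    case (Suc d)
    then obtain p where "awalk (Suc u) p (Suc u + d)" "length p = d"
      using Suc.IH[of "Suc u"] by auto
    with Suc.prems have "awalk u ((u, Suc u) # p) (u + Suc d)"
      by (auto simp: awalk_Cons_iff)
    with \<open>length p = d\<close> show ?case by (intro exI[of _ "(u, Suc u) # p"]) auto
  qed
qed

lemma graph_dist_path_le:
  assumes "u + d < n"
  shows "graph_dist (path_graph n) u (u + d) \<le> ereal (real d)"
proof -
  obtain p where "pre_digraph.awalk (with_proj (path_graph n)) u p (u + d)" "length p = d"
    using path_awalk_exists[OF assms] by blast
  then show ?thesis
    unfolding graph_dist_eq[OF pair_graph_path_graph] by (intro INF_lower2[of p]) auto
qed

lemma graph_dist_path_le_iff:
  assumes "u < n" "v < n"
  shows "graph_dist (path_graph n) u v \<le> ereal (real l) \<longleftrightarrow> u \<le> v + l \<and> v \<le> u + l"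
proof
  assume le: "graph_dist (path_graph n) u v \<le> ereal (real l)"
  \<comment> \<open>With truncated subtraction, this maximum is
    \<open>\<bar>u - v\<bar>\<close>.\<close>
  have "ereal (real (max (u - v) (v - u))) \<le> graph_dist (path_graph n) u v"
    unfolding graph_dist_eq[OF pair_graph_path_graph]
    using path_awalk_length by (intro INF_greatest) fastforce
  with le have "ereal (real (max (u - v) (v - u))) \<le> ereal (real l)" by (rule order_trans[rotated])
  then show "u \<le> v + l \<and> v \<le> u + l" by simp linarith
next
  assume close: "u \<le> v + l \<and> v \<le> u + l"
  have "graph_dist (path_graph n) u v \<le> ereal (real (max (u - v) (v - u)))"
  proof (cases "u \<le> v")
    case True
    then show ?thesis using graph_dist_path_le[of u "v - u" n] assms by simp
  next
    case False
    then show ?thesis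
      using graph_dist_path_le[of v "u - v" n] assms
      by (simp add: graph_dist_commute[OF pair_graph_path_graph, of n u v])
  qed
  also have "\<dots> \<le> ereal (real l)" using close by simp linarith
  finally show "graph_dist (path_graph n) u v \<le> ereal (real l)" .
qed

section \<open>Dominating sets of powers of paths\<close>

text \<open>The choice \<open>u = v\<close> is allowed, which absorbs the case that a vertex lies in
  \<open>D\<close> itself.\<close>

definition path_dominating :: "nat \<Rightarrow> nat \<Rightarrow> nat set set" where
  "path_dominating l n = {D. D \<subseteq> {..<n} \<and> (\<forall>v<n. \<exists>u\<in>D. u \<le> v + l \<and> v \<le> u + l)}"

lemma dominating_set_path_power:
  "dominating_set (graph_power l (path_graph n)) D \<longleftrightarrow> D \<in> path_dominating l n"
proof (cases "D \<subseteq> {..<n}")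
  case True
  have "(v \<in> D \<or> (\<exists>u\<in>D. (v, u) \<in> parcs (graph_power l (path_graph n)))) \<longleftrightarrow>
      (\<exists>u\<in>D. u \<le> v + l \<and> v \<le> u + l)" if "v < n" for v
  proof -
    have "(v, u) \<in> parcs (graph_power l (path_graph n)) \<longleftrightarrow> u \<noteq> v \<and> u \<le> v + l \<and> v \<le> u + l"
      if "u \<in> D" for u
      using that True \<open>v < n\<close> graph_dist_path_le_iff[of v n u l]
      by auto
    then show ?thesis by (metis le_add1)
  qed
  with True show ?thesis
    by (auto simp: dominating_set_def path_dominating_def)
next
  case False
  then show ?thesis
    by (auto simp: dominating_set_def path_dominating_def)
qed

text \<open>Grouping the sets by cardinality turns the coefficients into a weighted sum over sets,
  which can be reindexed by bijections.\<close>

lemma domination_poly_eq_sum: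
  assumes "finite (pverts G)"
  shows "domination_poly G = (\<Sum>D | dominating_set G D. X ^ card D)"
proof -
  let ?S = "{D. dominating_set G D}"
  have sub: "?S \<subseteq> Pow (pverts G)" by (auto simp: dominating_set_def)
  then have fin: "finite ?S" using assms by (auto intro: finite_subset)
  have "(\<Sum>D\<in>?S. X ^ card D) = (\<Sum>k\<le>card (pverts G). \<Sum>D\<in>{D \<in> ?S. card D = k}. X ^ card D)"
    using sub assms by (intro sum.group[symmetric] fin) (auto intro: card_mono)
  also have "\<dots> = domination_poly G"
    unfolding domination_poly_def
    by (intro sum.cong refl)
      (simp add: num_dominating_def monom_altdef of_nat_poly)
  finally show ?thesis ..
qed

lemma path_power_poly_eq: "\<gamma>P l n = (\<Sum>D\<in>path_dominating l n. X ^ card D)"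
proof -
  have "{D. dominating_set (graph_power l (path_graph n)) D} = path_dominating l n"
    by (simp only: dominating_set_path_power Collect_mem_eq)
  then show ?thesis by (simp add: domination_poly_eq_sum)
qed

lemma finite_path_dominating: "finite (path_dominating l n)"
  by (rule finite_subset[of _ "Pow {..<n}"]) (auto simp: path_dominating_def)

section \<open>Adding a new largest vertex; single dominating vertices\<close>

lemma path_dominatingD:
  assumes "D \<in> path_dominating l n" "0 < n"
  shows "finite D" "D \<noteq> {}" "D \<subseteq> {..<n}"
  using assms by (auto simp: path_dominating_def intro: finite_subset)

text \<open>Path and last dominator are extended by the same \<open>j\<close>, so the distance from
  the last dominator to the end is unchanged. Only the \<open>j - 1\<close> vertices strictly
  between \<open>Max D\<close> and \<open>Max D + j\<close> are at issue, and each side reaches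
  \<open>l\<close> of them.\<close>

lemma insert_path_dominating_iff:
  assumes D: "finite D" "D \<noteq> {}" and j: "0 < j"
  shows "insert (Max D + j) D \<in> path_dominating l (n + j) \<longleftrightarrow>
    D \<in> path_dominating l n \<and> j \<le> 2 * l + 1"
proof
  let ?m = "Max D"
  have m: "?m \<in> D" "\<And>u. u \<in> D \<Longrightarrow> u \<le> ?m" using D by auto
  {
    assume E: "insert (?m + j) D \<in> path_dominating l (n + j)"
    then have "?m < n" by (auto simp: path_dominating_def)
    have dom: "\<exists>u\<in>insert (?m + j) D. u \<le> v + l \<and> v \<le> u + l" if "v < n + j" for v
      using E that by (auto simp: path_dominating_def)
    have "D \<subseteq> {..<n}" using m(2) \<open>?m < n\<close> by force
    moreover have "\<exists>u\<in>D. u \<le> v + l \<and> v \<le> u + l" if "v < n" for v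
    proof (cases "v \<le> ?m")
      case True
      obtain u where "u \<in> insert (?m + j) D" "u \<le> v + l" "v \<le> u + l"
        using dom[of v] \<open>v < n\<close> by auto
      then consider "u \<in> D" | "u = ?m + j" by auto
      then show ?thesis
      proof cases
        case 1
        with \<open>u \<le> v + l\<close> \<open>v \<le> u + l\<close> show ?thesis by blast
      next
        \<comment> \<open>A vertex up to \<open>Max D\<close> that the new element reaches is also
          reached by \<open>Max D\<close>, which is nearer.\<close>
        case 2
        with \<open>u \<le> v + l\<close> True m(1) show ?thesis by (intro bexI[of _ ?m]) auto
      qed
    next
      case False
      \<comment> \<open>Whatever dominates \<open>v + j\<close> is at most \<open>Max D + j\<close>;
        cancelling \<open>j\<close> brings \<open>v\<close> within reach of
        \<open>Max D\<close>.\<close>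
      have "v + j < n + j" using \<open>v < n\<close> by simp
      from dom[OF this] obtain u
        where "u \<in> insert (?m + j) D" "u \<le> v + j + l" "v + j \<le> u + l" by blast
      then have "v \<le> ?m + l" using m(2)[of u] by auto
      then show ?thesis using False m(1) by (intro bexI[of _ ?m]) auto
    qed
    moreover have "j \<le> 2 * l + 1"
    proof (rule ccontr)
      assume "\<not> j \<le> 2 * l + 1"
      \<comment> \<open>The vertex \<open>Max D + l + 1\<close> is just out of reach of
        \<open>D\<close>, and too far below \<open>Max D + j\<close> if the gap exceeds
        \<open>2 * l + 1\<close>.\<close>
      then obtain u where "u \<in> insert (?m + j) D" "u \<le> ?m + l + 1 + l" "?m + l + 1 \<le> u + l"
        using dom[of "?m + l + 1"] \<open>?m < n\<close> by auto
      then show False using m(2)[of u] \<open>\<not> j \<le> 2 * l + 1\<close> by auto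
    qed
    ultimately show "D \<in> path_dominating l n \<and> j \<le> 2 * l + 1"
      by (simp add: path_dominating_def)
  }
  {
    assume *: "D \<in> path_dominating l n \<and> j \<le> 2 * l + 1"
    then have sub: "D \<subseteq> {..<n}" and dom: "\<And>v. v < n \<Longrightarrow> \<exists>u\<in>D. u \<le> v + l \<and> v \<le> u + l"
      by (auto simp: path_dominating_def)
    have "\<exists>u\<in>insert (?m + j) D. u \<le> v + l \<and> v \<le> u + l" if "v < n + j" for v
    proof -
      consider "v \<le> ?m" | "?m < v" "v \<le> ?m + l" | "?m + l < v" "v \<le> ?m + j" | "?m + j < v"
        by linarith
      then show ?thesis
      proof cases
        case 1
        then have "v < n" using m(1) sub by auto
        then show ?thesis using dom by blast
      next
        case 2
        then show ?thesis using m(1) by (intro bexI[of _ ?m]) auto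
      next
        \<comment> \<open>Since \<open>v\<close> is at least \<open>Max D + l + 1\<close>, the bound
          on \<open>j\<close> leaves \<open>Max D + j\<close> at most \<open>l\<close> above
          it.\<close>
        case 3
        then show ?thesis using * by (intro bexI[of _ "?m + j"]) auto
      next
        case 4
        \<comment> \<open>The end segment is shifted back by \<open>j\<close> into the shorter path,
          where domination of \<open>v - j\<close> bounds it by \<open>Max D + l\<close>.\<close>
        then have "v - j < n" using \<open>v < n + j\<close> by simp
        from dom[OF this] obtain u where "u \<in> D" "v - j \<le> u + l" by blast
        then have "v \<le> ?m + j + l" using m(2)[of u] by auto
        then show ?thesis using 4 by (intro bexI[of _ "?m + j"]) auto
      qed
    qed
    moreover have "insert (?m + j) D \<subseteq> {..<n + j}" using sub m(1) by auto
    ultimately show "insert (?m + j) D \<in> path_dominating l (n + j)"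
      by (simp add: path_dominating_def)
  }
qed

text \<open>Only the end vertices \<open>0\<close> and \<open>n - 1\<close> matter: a vertex within
  \<open>l\<close> of both is within \<open>l\<close> of all others.\<close>

lemma singleton_path_dominating_iff:
  assumes "0 < n"
  shows "{m} \<in> path_dominating l n \<longleftrightarrow> m < n \<and> m \<le> l \<and> n \<le> m + l + 1"
proof
  assume "{m} \<in> path_dominating l n"
  then have "m < n" "\<And>v. v < n \<Longrightarrow> m \<le> v + l \<and> v \<le> m + l"
    by (auto simp: path_dominating_def)
  from this(1) this(2)[of 0] this(2)[of "n - 1"] assms
  show "m < n \<and> m \<le> l \<and> n \<le> m + l + 1" by auto
qed (auto simp: path_dominating_def)

section \<open>The recurrences\<close>

text \<open>The dominating vertices form an interval. Its length is \<open>n\<close> up to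
  \<open>n = l + 1\<close>, then \<open>2 * l + 2 - n\<close>, truncated at zero.\<close>

lemma sum_singleton_path_dominating:
  assumes "0 < n"
  shows "(\<Sum>D\<in>{D \<in> path_dominating l n. card D = 1}. X ^ card D) =
    smult (int (min n (2 * l + 2 - n))) X"
proof -
  have "{D \<in> path_dominating l n. card D = 1} = (\<lambda>m. {m}) ` {n - 1 - l..<min n (l + 1)}"
    using assms by (auto simp: card_1_singleton_iff singleton_path_dominating_iff)
  moreover have "card {n - 1 - l..<min n (l + 1)} = min n (2 * l + 2 - n)"
    using assms by auto
  ultimately show ?thesis by (simp add: sum.reindex of_nat_poly del: card_atLeastLessThan)
qed

text \<open>A set corresponds bijectively to its top gap and the set without its maximum. The bound
  \<open>n - 1\<close> keeps the shorter path nonempty, so that the remaining set has a maximum to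
  which the gap can be added.\<close>

lemma sum_nonsingleton_path_dominating:
  assumes "0 < n"
  shows "(\<Sum>D\<in>{D \<in> path_dominating l n. card D \<noteq> 1}. X ^ card D) =
    X * (\<Sum>j = 1..min (n - 1) (2 * l + 1). \<gamma>P l (n - j))"
proof -
  let ?S = "{D \<in> path_dominating l n. card D \<noteq> 1}"
  let ?J = "{1..min (n - 1) (2 * l + 1)}"
  let ?T = "Sigma ?J (\<lambda>j. path_dominating l (n - j))"
  let ?rest = "\<lambda>E. E - {Max E}"
  let ?gap = "\<lambda>E. Max E - Max (?rest E)"
  let ?ins = "\<lambda>(j, D). insert (Max D + j) D"
  have split: "finite (?rest E)" "?rest E \<noteq> {}" "0 < ?gap E"
    "insert (Max (?rest E) + ?gap E) (?rest E) = E" "?gap E < n" if "E \<in> ?S" for E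
  proof -
    have E: "finite E" "E \<noteq> {}" "E \<subseteq> {..<n}"
      using that assms path_dominatingD[of E l n] by auto
    with that show fin: "finite (?rest E)" and ne: "?rest E \<noteq> {}"
      by (auto simp: card_1_singleton_iff)
    have "Max (?rest E) \<in> ?rest E" using fin ne by (rule Max_in)
    then have lt: "Max (?rest E) < Max E" using E by (auto simp: le_neq_implies_less)
    then show "0 < ?gap E" by simp
    have "Max E \<in> E" using E by simp
    then show "insert (Max (?rest E) + ?gap E) (?rest E) = E" "?gap E < n"
      using lt E(3) by auto
  qed
  have add: "finite D" "Max D + j \<notin> D" "D \<noteq> {}" "Max (insert (Max D + j) D) = Max D + j"
    "0 < j" "j < n" "j \<le> 2 * l + 1"
    if "(j, D) \<in> ?T" for j D
  proof -
    show *: "0 < j" "j < n" "j \<le> 2 * l + 1" using that assms by auto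
    show D: "finite D" "D \<noteq> {}" using that * path_dominatingD[of D l "n - j"] by auto
    show "Max D + j \<notin> D" using D * Max_ge[of D "Max D + j"] by auto
    show "Max (insert (Max D + j) D) = Max D + j" using D by simp
  qed
  have "(\<Sum>E\<in>?S. X ^ card E) = (\<Sum>(j, D)\<in>?T. X * X ^ card D)"
  \<comment> \<open>Cases 1 and 3 say that splitting and inserting are mutually inverse, 2 and 4
    that they map into the right sets; in 5 the factor \<open>X\<close> accounts for the removed
    maximum.\<close>
  proof (rule sum.reindex_bij_witness[where i = ?ins and j = "\<lambda>E. (?gap E, ?rest E)"], goal_cases)
    case (1 E)
    show ?case using split(4)[OF 1] by (simp only: prod.case)
  next
    case (2 E)
    note s = split[OF 2]
    \<comment> \<open>As the gap is below \<open>n\<close>, nothing truncates, and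
      \<open>insert_path_dominating_iff\<close> applies to the path with \<open>n - ?gap E\<close>
      vertices.\<close>
    have "n - ?gap E + ?gap E = n" using s(5) by linarith
    then have "?rest E \<in> path_dominating l (n - ?gap E) \<and> ?gap E \<le> 2 * l + 1"
      using 2 insert_path_dominating_iff[OF s(1-3), of l "n - ?gap E", unfolded s(4)]
      by (simp only: mem_Collect_eq simp_thms)
    moreover have "?gap E \<in> ?J" if "?gap E \<le> 2 * l + 1"
      using s(3,5) that unfolding atLeastAtMost_iff by linarith
    ultimately show ?case by (intro SigmaI) blast+
  next
    case (3 p)
    obtain j D where p: "p = (j, D)" by (cases p)
    note a = add[OF 3[unfolded p]]
    from a(2) have "insert (Max D + j) D - {Max D + j} = D" by simp
    with a(4) show ?case by (simp only: p prod.case add_diff_cancel_left')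
  next
    case (4 p)
    obtain j D where p: "p = (j, D)" by (cases p)
    note a = add[OF 4[unfolded p]]
    have "insert (Max D + j) D \<in> path_dominating l n"
      using insert_path_dominating_iff[OF a(1,3,5), of l "n - j"] a(6,7) 4 p
      by (simp del: Max_insert)
    moreover have "card (insert (Max D + j) D) \<noteq> 1" using a by simp
    ultimately show ?case using p by simp
  next
    case (5 E)
    then have "Max E \<in> E" "finite E" using path_dominatingD[of E l n] assms by auto
    then have "card E = Suc (card (?rest E))" by (rule card.remove[rotated])
    then show ?case by (simp only: prod.case power_Suc)
  qed
  also have "\<dots> = X * (\<Sum>j\<in>?J. \<gamma>P l (n - j))"
    unfolding path_power_poly_eq sum_distrib_left
    by (subst sum.Sigma) (auto simp: finite_path_dominating)
  finally show ?thesis .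
qed

lemma path_power_poly_rec:
  assumes "0 < n"
  shows "\<gamma>P l n = smult (int (min n (2 * l + 2 - n))) X +
    X * (\<Sum>j = 1..min (n - 1) (2 * l + 1). \<gamma>P l (n - j))"
proof -
  have "\<gamma>P l n = (\<Sum>D\<in>{D \<in> path_dominating l n. card D = 1}. X ^ card D) +
      (\<Sum>D\<in>{D \<in> path_dominating l n. card D \<noteq> 1}. X ^ card D)"
    unfolding path_power_poly_eq
    by (subst sum.union_disjoint[symmetric])
      (auto simp: finite_path_dominating intro!: sum.cong)
  then show ?thesis
    using sum_singleton_path_dominating[OF assms] sum_nonsingleton_path_dominating[OF assms] by simp
qed

section \<open>Recurrences as instances and differences of the identity\<close>

lemma path_power_poly_0: "\<gamma>P l 0 = 1"
proof -
  have "path_dominating l 0 = {{}}" by (auto simp: path_dominating_def)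
  then show ?thesis by (simp add: path_power_poly_eq)
qed

text \<open>Splitting off \<open>j = 1\<close> exposes the sum shared by the instances for
  \<open>n\<close> and \<open>Suc n\<close>.\<close>

lemma sum_shift_path_power_poly:
  "(\<Sum>j = 1..Suc k. \<gamma>P l (Suc n - j)) = \<gamma>P l n + (\<Sum>j = 1..k. \<gamma>P l (n - j))"
  unfolding One_nat_def sum.atLeast1_atMost_eq sum.lessThan_Suc_shift by simp

lemma path_power_poly_le:
  assumes "0 < n" "n \<le> l + 1"
  shows "\<gamma>P l n = smult (int n) X + X * (\<Sum>j = 1..n - 1. \<gamma>P l (n - j))"
proof -
  have "min n (2 * l + 2 - n) = n" "min (n - 1) (2 * l + 1) = n - 1" using assms by auto
  then show ?thesis using path_power_poly_rec[OF assms(1), of l] by (simp only:)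
qed

text \<open>The range includes \<open>n = l + 1\<close>, where \<open>n\<close> and
  \<open>2 * l + 2 - n\<close> coincide, and \<open>n = 2 * l + 1\<close>, with coefficient 1;
  taking differences uses both ends.\<close>

lemma path_power_poly_ge:
  assumes "l + 1 \<le> n" "n \<le> 2 * l + 1"
  shows "\<gamma>P l n = smult (2 * int l + 2 - int n) X + X * (\<Sum>j = 1..n - 1. \<gamma>P l (n - j))"
proof -
  have "0 < n" "int (min n (2 * l + 2 - n)) = 2 * int l + 2 - int n"
    "min (n - 1) (2 * l + 1) = n - 1" using assms by auto
  then show ?thesis using path_power_poly_rec[of n l] by (simp only:)
qed

text \<open>From \<open>n\<close> to \<open>Suc n\<close> the number of dominating vertices grows by
  one and the sum gains \<open>\<gamma>P l n\<close>.\<close>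

lemma path_power_poly_Suc_small:
  assumes "0 < n" "n \<le> l"
  shows "\<gamma>P l (Suc n) = (1 + X) * \<gamma>P l n + X"
proof -
  \<comment> \<open>Here \<open>a\<close> and \<open>g\<close> stand for the consecutive
    polynomials, \<open>s\<close> for their shared sum, and \<open>c\<close> for the single-vertex
    term of \<open>g\<close>.\<close>
  have step: "a = (1 + x) * g + x" if "a = c + x + x * (g + s)" "g = c + x * s"
    for a c g s x :: "int poly"
    using that by (simp add: algebra_simps)
  obtain k where n: "n = Suc k" using assms by (cases n) auto
  let ?S = "\<Sum>j = 1..k. \<gamma>P l (n - j)"
  have "\<gamma>P l (Suc n) = smult (int n + 1) X + X * (\<gamma>P l n + ?S)"
    using path_power_poly_le[of "Suc n" l] assms sum_shift_path_power_poly[of l n k]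
    by (simp add: n add.commute del: sum.cl_ivl_Suc)
  also have "smult (int n + 1) X = smult (int n) X + X" by simp
  finally have "\<gamma>P l (Suc n) = smult (int n) X + X + X * (\<gamma>P l n + ?S)" .
  moreover have "\<gamma>P l n = smult (int n) X + X * ?S"
    using path_power_poly_le[of n l] assms by (simp add: n)
  ultimately show ?thesis by (rule step)
qed

text \<open>In this range the number of dominating vertices falls by one at each step, hence the
  minus sign.\<close>

lemma path_power_poly_Suc_medium:
  assumes "l + 1 \<le> n" "n \<le> 2 * l"
  shows "\<gamma>P l (Suc n) = (1 + X) * \<gamma>P l n - X"
proof -
  have step: "a = (1 + x) * g - x" if "a = c + x * (g + s)" "g = d + x * s" "d = c + x"
    for a c d g s x :: "int poly"
    using that by (simp add: algebra_simps)
  obtain k where n: "n = Suc k" using assms by (cases n) auto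
  let ?S = "\<Sum>j = 1..k. \<gamma>P l (n - j)"
  let ?c = "2 * int l + 1 - int n"
  have "\<gamma>P l (Suc n) = smult ?c X + X * (\<gamma>P l n + ?S)"
    using path_power_poly_ge[of l "Suc n"] assms sum_shift_path_power_poly[of l n k]
    by (simp add: n del: sum.cl_ivl_Suc)
  moreover have "\<gamma>P l n = smult (?c + 1) X + X * ?S"
    using path_power_poly_ge[of l n] assms by (simp add: n)
  moreover have "smult (?c + 1) X = smult ?c X + X" by simp
  ultimately show ?thesis by (rule step)
qed

lemma path_power_poly_large:
  assumes "2 * l + 1 \<le> n"
  shows "\<gamma>P l n = X * (\<Sum>j = 1..2 * l + 1. \<gamma>P l (n - j))"
proof (cases "n = 2 * l + 1")
  case True
  \<comment> \<open>One vertex dominates and the sum stops at \<open>j = 2 * l\<close>; the extra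
    \<open>X\<close> is the missing summand, as \<open>\<gamma>P l 0 = 1\<close>.\<close>
  then show ?thesis
    using path_power_poly_rec[of n l] path_power_poly_0[of l]
    by (simp add: algebra_simps)
next
  case False
  with assms have "0 < n" "min n (2 * l + 2 - n) = 0" "min (n - 1) (2 * l + 1) = 2 * l + 1"
    by auto
  then show ?thesis
    using path_power_poly_rec[of n l] by (simp only: of_nat_0 smult_0_left add_0_left)
qed

text \<open>The sum runs over a window of fixed length \<open>2 * l + 1\<close>; moving it one step
  gains \<open>\<gamma>P l n\<close> and loses its oldest term.\<close>

lemma path_power_poly_Suc_large:
  assumes "2 * l + 1 \<le> n"
  shows "\<gamma>P l (Suc n) = (1 + X) * \<gamma>P l n - X * \<gamma>P l (Suc n - 2 * (l + 1))"
proof -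
  have step: "a = (1 + x) * g - x * b" if "t = g + s - b" "a = x * t" "g = x * s"
    for a b g s t x :: "int poly"
    unfolding that by (simp add: algebra_simps)
  let ?S = "\<lambda>n. \<Sum>j = 1..2 * l + 1. \<gamma>P l (n - j)"
  have "?S (Suc n) + \<gamma>P l (Suc n - 2 * (l + 1)) = (\<Sum>j = 1..Suc (2 * l + 1). \<gamma>P l (Suc n - j))"
    by simp
  also have "\<dots> = \<gamma>P l n + ?S n" by (rule sum_shift_path_power_poly)
  finally have "?S (Suc n) = \<gamma>P l n + ?S n - \<gamma>P l (Suc n - 2 * (l + 1))"
    by (simp only: eq_diff_eq)
  moreover have "\<gamma>P l (Suc n) = X * ?S (Suc n)" "\<gamma>P l n = X * ?S n"
    using assms by (intro path_power_poly_large; simp)+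
  ultimately show ?thesis by (rule step)
qed

text \<open>In this range any two vertices are within distance \<open>l\<close>, so every nonempty
  set dominates. The formula is obtained by iterating \<open>path_power_poly_Suc_small\<close> from
  \<open>n = 1\<close>.\<close>

lemma path_power_poly_small:
  assumes "1 \<le> n" "n \<le> l + 1"
  shows "\<gamma>P l n = (1 + X) ^ n - 1"
  using assms
proof (induction n rule: dec_induct)
  case base
  then show ?case using path_power_poly_rec[of 1 l] by simp
next
  case (step n)
  have "(1 + x) * ((1 + x) ^ n - 1) + x = (1 + x) ^ Suc n - 1" for x :: "int poly"
    by (simp add: algebra_simps)
  moreover have "\<gamma>P l (Suc n) = (1 + X) * \<gamma>P l n + X" "\<gamma>P l n = (1 + X) ^ n - 1"
    using step path_power_poly_Suc_small[of n l] by auto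
  ultimately show ?case by (simp only:)
qed

theorem theorem5:
  fixes l :: nat
  assumes "1 \<le> l"
  shows
    "(\<gamma>P l 0 = 1 \<and>
      \<gamma>P l 1 = X \<and>
      (\<forall>n. 2 \<le> n \<and> n \<le> l + 1 \<longrightarrow>
         \<gamma>P l n = smult (int n) X + X * (\<Sum>j = 1..n - 1. \<gamma>P l (n - j))) \<and>
      (\<forall>n. l + 2 \<le> n \<and> n \<le> 2 * l \<longrightarrow>
         \<gamma>P l n = smult (2 * int l + 2 - int n) X + X * (\<Sum>j = 1..n - 1. \<gamma>P l (n - j))) \<and>
      (\<forall>n. 2 * l + 1 \<le> n \<longrightarrow>
         \<gamma>P l n = X * (\<Sum>j = 1..2 * l + 1. \<gamma>P l (n - j)))) \<and>
     (\<gamma>P l 0 = 1 \<and>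
      (\<forall>n. 1 \<le> n \<and> n \<le> l + 1 \<longrightarrow> \<gamma>P l n = (1 + X) ^ n - 1) \<and>
      (\<forall>n. l + 2 \<le> n \<and> n \<le> 2 * l + 1 \<longrightarrow>
         \<gamma>P l n = (1 + X) * \<gamma>P l (n - 1) - X) \<and>
      (\<forall>n. 2 * l + 2 \<le> n \<longrightarrow>
         \<gamma>P l n = (1 + X) * \<gamma>P l (n - 1) - X * \<gamma>P l (n - 2 * (l + 1))))"
proof (intro conjI allI impI; (elim conjE)?)
  show "\<gamma>P l 0 = 1" "\<gamma>P l 0 = 1" by (rule path_power_poly_0)+
  show "\<gamma>P l 1 = X" using path_power_poly_rec[of 1 l] by simp
next
  fix n assume "2 \<le> n" "n \<le> l + 1"
  then show "\<gamma>P l n = smult (int n) X + X * (\<Sum>j = 1..n - 1. \<gamma>P l (n - j))"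
    by (intro path_power_poly_le; linarith)
next
  fix n assume "l + 2 \<le> n" "n \<le> 2 * l"
  then show "\<gamma>P l n = smult (2 * int l + 2 - int n) X + X * (\<Sum>j = 1..n - 1. \<gamma>P l (n - j))"
    by (intro path_power_poly_ge; linarith)
next
  fix n assume "2 * l + 1 \<le> n"
  then show "\<gamma>P l n = X * (\<Sum>j = 1..2 * l + 1. \<gamma>P l (n - j))"
    by (rule path_power_poly_large)
next
  fix n assume "1 \<le> n" "n \<le> l + 1"
  then show "\<gamma>P l n = (1 + X) ^ n - 1" by (rule path_power_poly_small)
next
  fix n assume "l + 2 \<le> n" "n \<le> 2 * l + 1"
  \<comment> \<open>The successor forms are applied at \<open>n - 1\<close>, which is why the bounds
    drop by one.\<close>
  then have "Suc (n - 1) = n" "l + 1 \<le> n - 1" "n - 1 \<le> 2 * l" by linarith+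
  then show "\<gamma>P l n = (1 + X) * \<gamma>P l (n - 1) - X"
    using path_power_poly_Suc_medium[of l "n - 1"] by (simp only:)
next
  fix n assume "2 * l + 2 \<le> n"
  then have "Suc (n - 1) = n" "2 * l + 1 \<le> n - 1" by linarith+
  then show "\<gamma>P l n = (1 + X) * \<gamma>P l (n - 1) - X * \<gamma>P l (n - 2 * (l + 1))"
    using path_power_poly_Suc_large[of l "n - 1"] by (simp only:)
qed

end
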